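(* Let $\mathbb{K}=\mathbb{R}$ or $\mathbb{C}$, let $n\geq 1$, and let $\mathcal{G}$ be an abelian subgroup of $GL(n,\mathbb{K})$. Then $\mathcal{G}$ has height at most $n$, i.e. $ht(\mathcal{G})\leq n$.
   Context: $\mathcal{G}$ acts linearly on $\mathbb{K}^n$ by $(A,v)\mapsto Av$, and the orbit of $v$ is $\mathcal{G}(v)=\{Av: A\in\mathcal{G}\}$. A subset of $\mathbb{K}^n$ is $\mathcal{G}$-invariant if it is a union of orbits. If $V$ is a $\mathcal{G}$-invariant open set, a minimal set in $V$ is a non-empty $\mathcal{G}$-invariant subset of $V$, closed in $V$, with no proper subset having these properties; an orbit $O\subset V$ is minimal in $V$ if $\overline{O}\cap V$ is a minimal set in $V$ ($\overline{O}$ is the closure in $\mathbb{K}^n$). The class $cl(L)$ of an orbit $L$ is the (union of the) set of orbits $O$ of $\mathcal{G}$ such that $\overline{O}=\overline{L}$. Levels of orbits: the fixed orbit $\{0\}$ is regarded as having level $0$. An orbit $L\subset\mathbb{K}^n-\{0\}$ is at level $1$ if $L$ is minimal in $\mathbb{K}^n-\{0\}$. Inductively, for $p\geq 2$, $L$ is at level $p$ if every orbit $O\subset\overline{L}-cl(L)$ is at level $<p$, with at least one such orbit at level $k$ for every $1\leq k<p$. The upper bound of the levels of orbits of $\mathcal{G}$ is the height of $\mathcal{G}$, denoted $ht(\mathcal{G})$. If it is finite, it is the supremum of the integers $k$ such that there exist orbits $\gamma_1,\dots,\gamma_k$ of $\mathcal{G}$ in $\mathbb{K}^n-\{0\}$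 with $\overline{\gamma_1}\subset\overline{\gamma_2}\subset\dots\subset\overline{\gamma_k}$ and $\overline{\gamma_i}\neq\overline{\gamma_j}$ for $i\neq j$. *)

theory Defs
  imports "HOL-Analysis.Analysis" "HOL-Algebra.Group" "HOL-Library.Extended_Nat"
begin

definition GL :: "('k::field ^ 'n ^ 'n) monoid" where
  "GL = \<lparr>carrier = {A. invertible A}, mult = (**), one = mat 1\<rparr>"

lemma group_GL: "group (GL :: ('k::field ^ 'n ^ 'n) monoid)"
proof (rule groupI)
  fix A :: "'k ^ 'n ^ 'n"
  assume "A \<in> carrier GL"
  then obtain B where "A ** B = mat 1" "B ** A = mat 1"
    by (auto simp: GL_def invertible_def)
  then show "\<exists>B\<in>carrier GL. B \<otimes>\<^bsub>GL\<^esub> A = \<one>\<^bsub>GL\<^esub>"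
    by (auto simp: GL_def invertible_def)
next
  show "\<one>\<^bsub>GL\<^esub> \<in> carrier (GL :: ('k ^ 'n ^ 'n) monoid)"
    by (auto simp: GL_def invertible_def intro: exI[of _ "mat 1"])
qed (simp_all add: GL_def invertible_mult matrix_mul_assoc)

definition abelian_linear_group :: "('k::field ^ 'n ^ 'n) set \<Rightarrow> bool" where
  "abelian_linear_group G \<longleftrightarrow> subgroup G GL \<and> comm_group (GL\<lparr>carrier := G\<rparr>)"

definition mat_orbit :: "('k::field ^ 'n ^ 'n) set \<Rightarrow> 'k ^ 'n \<Rightarrow> ('k ^ 'n) set" where
  "mat_orbit G v = {A *v v | A. A \<in> G}"

definition mat_orbits :: "('k::field ^ 'n ^ 'n) set \<Rightarrow> ('k ^ 'n) set set" where
  "mat_orbits G = range (mat_orbit G)"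

definition invariant_set :: "('k::field ^ 'n ^ 'n) set \<Rightarrow> ('k ^ 'n) set \<Rightarrow> bool" where
  "invariant_set G S \<longleftrightarrow> (\<exists>\<O>\<subseteq>mat_orbits G. S = \<Union>\<O>)"

definition closed_invariant_in ::
    "('k::real_normed_field ^ 'n ^ 'n) set \<Rightarrow> ('k ^ 'n) set \<Rightarrow> ('k ^ 'n) set \<Rightarrow> bool" where
  "closed_invariant_in G V S \<longleftrightarrow>
     S \<noteq> {} \<and> S \<subseteq> V \<and> invariant_set G S \<and> closedin (top_of_set V) S"

definition minimal_set ::
    "('k::real_normed_field ^ 'n ^ 'n) set \<Rightarrow> ('k ^ 'n) set \<Rightarrow> ('k ^ 'n) set \<Rightarrow> bool" where
  "minimal_set G V S \<longleftrightarrow>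
     closed_invariant_in G V S \<and> (\<forall>T. T \<subset> S \<longrightarrow> \<not> closed_invariant_in G V T)"

definition minimal_orbit ::
    "('k::real_normed_field ^ 'n ^ 'n) set \<Rightarrow> ('k ^ 'n) set \<Rightarrow> ('k ^ 'n) set \<Rightarrow> bool" where
  "minimal_orbit G V L \<longleftrightarrow> L \<in> mat_orbits G \<and> L \<subseteq> V \<and> minimal_set G V (closure L \<inter> V)"

definition orbit_class ::
    "('k::real_normed_field ^ 'n ^ 'n) set \<Rightarrow> ('k ^ 'n) set \<Rightarrow> ('k ^ 'n) set" where
  "orbit_class G L = \<Union>{M \<in> mat_orbits G. closure M = closure L}"

inductive at_level ::
    "('k::real_normed_field ^ 'n ^ 'n) set \<Rightarrow> nat \<Rightarrow> ('k ^ 'n) set \<Rightarrow> bool"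
  for G where
  level_zero: "at_level G 0 {0}"
| level_one: "minimal_orbit G (UNIV - {0}) L \<Longrightarrow> at_level G 1 L"
| level_step: "\<lbrakk>p \<ge> 2; L \<in> mat_orbits G; L \<subseteq> UNIV - {0};
    \<forall>M\<in>mat_orbits G. M \<subseteq> closure L - orbit_class G L \<longrightarrow> (\<exists>k<p. at_level G k M);
    \<forall>k. 1 \<le> k \<and> k < p \<longrightarrow>
      (\<exists>M\<in>mat_orbits G. M \<subseteq> closure L - orbit_class G L \<and> at_level G k M)\<rbrakk>
    \<Longrightarrow> at_level G p L"

lemma minimal_orbit_not_in_closure_diff_class:
  assumes L: "minimal_orbit G V L" and M: "minimal_orbit G V M"
  shows "\<not> M \<subseteq> closure L - orbit_class G L"
proof
  assume sub: "M \<subseteq> closure L - orbit_class G L"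
  have le: "closure M \<subseteq> closure L"
    using sub by (meson Diff_subset closed_closure closure_minimal order_trans)
  have "closed_invariant_in G V (closure M \<inter> V)"
    using M by (simp add: minimal_orbit_def minimal_set_def)
  moreover have "closure M \<inter> V \<subseteq> closure L \<inter> V" using le by blast
  ultimately have "closure M \<inter> V = closure L \<inter> V"
    using L unfolding minimal_orbit_def minimal_set_def by blast
  moreover have "L \<subseteq> V" using L by (simp add: minimal_orbit_def)
  ultimately have "L \<subseteq> closure M" using closure_subset[of L] by blast
  then have "closure M = closure L"
    using le closure_minimal[of L "closure M"] by simp
  then have "M \<subseteq> orbit_class G L"
    using M unfolding orbit_class_def minimal_orbit_def by blast
  moreover have "M \<noteq> {}"
    using M by (auto simp: minimal_orbit_def minimal_set_def closed_invariant_in_def)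
  ultimately show False using sub by blast
qed

lemma at_level_zeroD: "at_level G 0 L \<Longrightarrow> L = {0}"
  by (erule at_level.cases) simp_all

lemma at_level_oneD: "at_level G (Suc 0) L \<Longrightarrow> minimal_orbit G (UNIV - {0}) L"
  by (erule at_level.cases) simp_all

lemma at_level_nonzeroD: "at_level G p L \<Longrightarrow> p \<noteq> 0 \<Longrightarrow> L \<subseteq> UNIV - {0}"
  by (erule at_level.cases) (simp_all add: minimal_orbit_def)

lemma at_level_lower:
  assumes "at_level G p L" "p \<ge> 2" "M \<in> mat_orbits G" "M \<subseteq> closure L - orbit_class G L"
  shows "\<exists>k<p. at_level G k M"
  using assms(1)
proof cases
  case level_step
  then show ?thesis using assms(3,4) by blast
qed (use assms(2) in simp_all)

lemma at_level_attained:
  assumes "at_level G p L" "1 \<le> k" "k < p"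
  shows "\<exists>M\<in>mat_orbits G. M \<subseteq> closure L - orbit_class G L \<and> at_level G k M"
  using assms(1)
proof cases
  case level_step
  then show ?thesis using assms(2,3) by blast
qed (use assms(2,3) in simp_all)

lemma at_level_unique: "at_level G p L \<Longrightarrow> at_level G q L \<Longrightarrow> p = q"
proof (induction "p + q" arbitrary: p q L rule: less_induct)
  case less
  have not_less: False if "a < b" and a: "at_level G a L" and b: "at_level G b L"
    and sum: "a + b = p + q" for a b
  proof -
    consider "a = 0" | "a = 1" "b \<ge> 2" | "a \<ge> 2" "b \<ge> 2" using \<open>a < b\<close> by linarith
    then show False
    proof cases
      case 1
      then have "L = {0}" using a at_level_zeroD by blast
      then show False using at_level_nonzeroD[OF b] \<open>a < b\<close> by simp
    next
      case 2
      have L: "minimal_orbit G (UNIV - {0}) L" using a 2 by (simp add: at_level_oneD)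
      obtain M where "M \<subseteq> closure L - orbit_class G L" "at_level G 1 M"
        using at_level_attained[OF b, of 1] 2 by auto
      then show False
        using minimal_orbit_not_in_closure_diff_class[OF L, of M] at_level_oneD[of G M] by simp
    next
      case 3
      obtain M where M: "M \<in> mat_orbits G" "M \<subseteq> closure L - orbit_class G L" "at_level G a M"
        using at_level_attained[OF b, of a] 3 \<open>a < b\<close> by auto
      then obtain k where k: "k < a" "at_level G k M"
        using at_level_lower[OF a] 3 by blast
      then have "k + a < p + q" using \<open>a < b\<close> sum by simp
      then show False using less.hyps[of k a M] k M by simp
    qed
  qed
  show ?case using not_less[of p q] not_less[of q p] less.prems by (metis add.commute nat_neq_iff)
qed

text \<open>The level of an orbit, unique if it exists by \<open>at_level_unique\<close>. An orbit that is at no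
  finite level gets level \<open>\<infinity>\<close> (the infimum of the empty set), so that a bound on the height says
  in particular that every orbit has a level. This convention is what makes a finite height the
  supremum of the lengths of strictly increasing chains of closures of nonzero orbits; if orbits
  without a level were ignored, infinite chains would not be excluded by the definition.\<close>

definition orbit_level :: "('k::real_normed_field ^ 'n ^ 'n) set \<Rightarrow> ('k ^ 'n) set \<Rightarrow> enat" where
  "orbit_level G L = Inf {enat p | p. at_level G p L}"

definition height :: "('k::real_normed_field ^ 'n ^ 'n) set \<Rightarrow> enat" where
  "height G = (SUP L\<in>mat_orbits G. orbit_level G L)"

end

theory Submission
  imports Defs
begin

text \<open>
  Attach to an orbit the dimension of the \<open>\<K>\<close>-subspace that it spans. This dimension drops strictly
  when an orbit is replaced by an orbit in its closure with a smaller closure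
  (\<open>dim_orbit_less\<close>). Since it is positive for an orbit other than \<open>{0}\<close> and at most \<open>n\<close>,
  induction on it gives every orbit \<open>L\<close> a level that is at most the dimension of its span
  (\<open>ex_level_le_dim\<close>), and this bounds the height by \<open>n\<close>.

  For the strict drop, let \<open>w\<close> lie in the closure of the orbit of \<open>v\<close>. The span of the orbit of
  \<open>v\<close> is closed, so it contains the span of the orbit of \<open>w\<close>; if the dimensions agree, the two spans
  are equal, and it has to be shown that \<open>v\<close> lies in the closure of the orbit of \<open>w\<close>
  (\<open>mem_closure_orbit_sym\<close>). Choose \<open>g\<close> in the group with \<open>g v\<close> close to \<open>w\<close>. The error
  \<open>e = w - g v\<close> is a small vector in the span of the orbit of \<open>w\<close>, hence \<open>e = c w\<close> for a
  linear combination \<open>c\<close> of group elements with small coefficients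
  (\<open>ex_small_commuting_operator\<close>). As the group is abelian, \<open>c\<close> commutes with \<open>g\<close>, so
  \<open>y = g\<^sup>-\<^sup>1 w\<close> satisfies \<open>y - v = g\<^sup>-\<^sup>1 e = c y\<close>. The operator \<open>c\<close> is small in norm, and
  therefore \<open>y\<close>, a point of the orbit of \<open>w\<close>, is close to \<open>v\<close>.

  The argument is the same over \<open>\<real>\<close> and \<open>\<complex>\<close>. It uses only that the scalars form a normed
  field that has finite dimension over \<open>\<real>\<close>, and it is written for such a field.
\<close>

section \<open>Matrices over a finite-dimensional normed field as real linear maps\<close>

lemma scaleR_eq_vector_scale: "r *\<^sub>R x = (of_real r :: 'k::real_normed_field) *s (x :: 'k ^ 'n)"
proof (unfold vec_eq_iff, intro allI)
  fix i
  show "(r *\<^sub>R x) $ i = (of_real r *s x) $ i"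
    unfolding vector_scaleR_component vector_smult_component by (rule scaleR_conv_of_real)
qed

lemma norm_vector_scale: "norm (k *s (x :: 'k::real_normed_field ^ 'n)) = norm k * norm x"
  by (simp add: norm_vec_def norm_mult L2_set_right_distrib)

lemma closed_vec_subspace:
  fixes S :: "('k::{euclidean_space,real_normed_field} ^ 'n) set"
  assumes "vec.subspace S"
  shows "closed S"
proof (rule closed_subspace)
  show "subspace S"
    using assms by (simp add: subspace_def vec.subspace_def scaleR_eq_vector_scale)
qed

lemma bounded_linear_matrix_vector_mult:
  fixes A :: "'k::{euclidean_space,real_normed_field} ^ 'n ^ 'm"
  shows "bounded_linear ((*v) A)"
proof -
  have "linear ((*v) A)"
    by (rule linearI) (simp_all add: scaleR_eq_vector_scale vec.add vec.scale)
  then show ?thesis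
    by (simp add: linear_conv_bounded_linear)
qed

lemma bounded_linear_representation:
  fixes B :: "('k::{euclidean_space,real_normed_field} ^ 'n) set"
  assumes "vec.independent B" "vec.span B = UNIV"
  shows "bounded_linear (\<lambda>x. vec.representation B x b)"
proof -
  have "linear (\<lambda>x. vec.representation B x b)"
    using assms
    by (intro linearI)
      (simp_all add: scaleR_eq_vector_scale vec.representation_add vec.representation_scale
        scaleR_conv_of_real)
  then show ?thesis
    by (simp add: linear_conv_bounded_linear)
qed

section \<open>Orbits of an abelian linear group\<close>

lemma abelian_linear_group_one: "abelian_linear_group G \<Longrightarrow> mat 1 \<in> G"
  using subgroup.one_closed[of G GL] by (simp add: abelian_linear_group_def GL_def)

lemma abelian_linear_group_mult:
  "abelian_linear_group G \<Longrightarrow> A \<in> G \<Longrightarrow> B \<in> G \<Longrightarrow> A ** B \<in> G"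
  using subgroup.m_closed[of G GL] by (simp add: abelian_linear_group_def GL_def)

lemma abelian_linear_group_inverse:
  assumes "abelian_linear_group G" "A \<in> G"
  obtains B where "B \<in> G" "B ** A = mat 1"
proof
  have sub: "subgroup G GL"
    using assms by (simp add: abelian_linear_group_def)
  show "inv\<^bsub>GL\<^esub> A \<in> G"
    using subgroup.m_inv_closed[OF sub assms(2)] .
  have "A \<in> carrier GL"
    using subgroup.mem_carrier[OF sub assms(2)] .
  then have "inv\<^bsub>GL\<^esub> A \<otimes>\<^bsub>GL\<^esub> A = \<one>\<^bsub>GL\<^esub>"
    by (rule group.l_inv[OF group_GL])
  then show "inv\<^bsub>GL\<^esub> A ** A = mat 1"
    by (simp add: GL_def)
qed

lemma abelian_linear_group_commute:
  assumes "abelian_linear_group G" "A \<in> G" "B \<in> G"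
  shows "A ** B = B ** A"
proof -
  have "comm_monoid (GL\<lparr>carrier := G\<rparr>)"
    using assms by (simp add: abelian_linear_group_def comm_group_def)
  from comm_monoid.m_comm[OF this, of A B] assms show ?thesis
    by (simp add: GL_def)
qed

lemma mat_orbitI: "A \<in> G \<Longrightarrow> A *v v \<in> mat_orbit G v"
  by (auto simp: mat_orbit_def)

lemma mat_orbit_refl: "abelian_linear_group G \<Longrightarrow> v \<in> mat_orbit G v"
  using mat_orbitI[of "mat 1" G v] by (simp add: abelian_linear_group_one)

lemma mat_orbit_subset:
  assumes "abelian_linear_group G" "w \<in> mat_orbit G v"
  shows "mat_orbit G w \<subseteq> mat_orbit G v"
  using assms by (force simp: mat_orbit_def matrix_vector_mul_assoc abelian_linear_group_mult)

lemma mat_orbit_sym: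
  assumes "abelian_linear_group G" "w \<in> mat_orbit G v"
  shows "v \<in> mat_orbit G w"
proof -
  obtain A where A: "A \<in> G" "w = A *v v"
    using assms(2) by (auto simp: mat_orbit_def)
  obtain B where B: "B \<in> G" "B ** A = mat 1"
    using abelian_linear_group_inverse[OF assms(1) A(1)] .
  have "B *v w = v"
    using A B by (simp add: matrix_vector_mul_assoc)
  then show ?thesis
    using mat_orbitI[OF B(1), of w] by simp
qed

lemma mat_orbit_eq:
  assumes "abelian_linear_group G" "w \<in> mat_orbit G v"
  shows "mat_orbit G w = mat_orbit G v"
  using assms mat_orbit_subset mat_orbit_sym by (metis subset_antisym)

lemma mat_orbits_eqI:
  assumes "abelian_linear_group G" "L \<in> mat_orbits G" "v \<in> L"
  shows "L = mat_orbit G v"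
  using assms mat_orbit_eq by (fastforce simp: mat_orbits_def)

lemma mat_orbit_zero:
  assumes "abelian_linear_group G"
  shows "mat_orbit G 0 = {0}"
  using abelian_linear_group_one[OF assms] by (auto simp: mat_orbit_def)

lemma mat_orbits_nonempty: "abelian_linear_group G \<Longrightarrow> L \<in> mat_orbits G \<Longrightarrow> L \<noteq> {}"
  using mat_orbit_refl by (fastforce simp: mat_orbits_def)

lemma mat_orbits_nonzero:
  assumes "abelian_linear_group G" "L \<in> mat_orbits G" "L \<noteq> {0}"
  shows "L \<subseteq> UNIV - {0}"
  using mat_orbits_eqI[OF assms(1,2), of 0] mat_orbit_zero[OF assms(1)] assms(3) by auto

lemma invariant_set_iff:
  assumes "abelian_linear_group G"
  shows "invariant_set G S \<longleftrightarrow> (\<forall>v\<in>S. mat_orbit G v \<subseteq> S)"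
proof
  assume "invariant_set G S"
  then show "\<forall>v\<in>S. mat_orbit G v \<subseteq> S"
    unfolding invariant_set_def using mat_orbits_eqI[OF assms] by blast
next
  assume *: "\<forall>v\<in>S. mat_orbit G v \<subseteq> S"
  then have "S = \<Union>(mat_orbit G ` S)"
    using mat_orbit_refl[OF assms] by blast
  then show "invariant_set G S"
    unfolding invariant_set_def by (intro exI[of _ "mat_orbit G ` S"]) (auto simp: mat_orbits_def)
qed

lemma mat_orbit_subset_closure:
  fixes G :: "('k::{euclidean_space,real_normed_field} ^ 'n ^ 'n) set"
  assumes G: "abelian_linear_group G" and w: "w \<in> closure (mat_orbit G v)"
  shows "mat_orbit G w \<subseteq> closure (mat_orbit G v)"
proof -
  have "A *v w \<in> closure (mat_orbit G v)" if A: "A \<in> G" for A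
  proof -
    have "(*v) A ` mat_orbit G v \<subseteq> mat_orbit G v"
      using A by (force simp: mat_orbit_def matrix_vector_mul_assoc abelian_linear_group_mult[OF G])
    then have "closure ((*v) A ` mat_orbit G v) \<subseteq> closure (mat_orbit G v)"
      by (rule closure_mono)
    then show ?thesis
      using closure_bounded_linear_image_subset[OF bounded_linear_matrix_vector_mult[of A]] w by blast
  qed
  then show ?thesis
    by (auto simp: mat_orbit_def)
qed

text \<open>Two orbits are equal or disjoint, so an orbit avoids the class of \<open>L\<close> as soon as its closure
  differs from that of \<open>L\<close>. This turns the set-theoretic condition on orbits below \<open>L\<close> into one
  on closures.\<close>

lemma orbit_below_iff:
  assumes G: "abelian_linear_group G" and M: "M \<in> mat_orbits G"
  shows "M \<subseteq> closure L - orbit_class G L \<longleftrightarrow> closure M \<subset> closure L"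
proof
  assume sub: "M \<subseteq> closure L - orbit_class G L"
  then have "closure M \<noteq> closure L"
    using M mat_orbits_nonempty[OF G M] by (auto simp: orbit_class_def)
  moreover have "closure M \<subseteq> closure L"
    using sub by (intro closure_minimal) auto
  ultimately show "closure M \<subset> closure L" by blast
next
  assume less: "closure M \<subset> closure L"
  have "x \<notin> orbit_class G L" if x: "x \<in> M" for x
  proof
    assume "x \<in> orbit_class G L"
    then obtain N where N: "N \<in> mat_orbits G" "closure N = closure L" "x \<in> N"
      by (auto simp: orbit_class_def)
    then have "M = N"
      using mat_orbits_eqI[OF G] M x by metis
    then show False using less N(2) by simp
  qed
  moreover have "M \<subseteq> closure L"
    using less closure_subset[of M] by blast
  ultimately show "M \<subseteq> closure L - orbit_class G L" by blast
qed

section \<open>Orbit closures and the spans of orbits\<close>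

text \<open>A basis of the span of the orbit of \<open>w\<close> can be chosen inside the orbit, as \<open>h\<^sub>b w = b\<close> with
  \<open>h\<^sub>b\<close> in the group. The operator with value \<open>e\<close> at \<open>w\<close> is then the combination of the \<open>h\<^sub>b\<close>
  whose coefficients are the coordinates of \<open>e\<close>. These depend continuously on \<open>e\<close>, so a small \<open>e\<close>
  gives a small operator.\<close>

lemma ex_small_commuting_operator:
  fixes G :: "('k::{euclidean_space,real_normed_field} ^ 'n ^ 'n) set" and w :: "'k ^ 'n"
  assumes G: "abelian_linear_group G" and eps: "\<epsilon> > 0"
  obtains \<delta> where "\<delta> > 0"
    "\<And>e. e \<in> vec.span (mat_orbit G w) \<Longrightarrow> norm e < \<delta> \<Longrightarrow>
      \<exists>c. c w = e \<and> (\<forall>A\<in>G. \<forall>y. c (A *v y) = A *v c y) \<and> (\<forall>y. norm (c y) \<le> \<epsilon> * norm y)"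
proof -
  obtain B where B: "B \<subseteq> mat_orbit G w" "vec.independent B" "mat_orbit G w \<subseteq> vec.span B"
    by (rule vec.maximal_independent_subset)
  have finB: "finite B"
    using B(2) by (rule vec.finiteI_independent)
  have spanB: "vec.span (mat_orbit G w) = vec.span B"
    using B(1,3) by (metis vec.span_mono vec.span_span subset_antisym)
  have "\<forall>b\<in>B. \<exists>A\<in>G. A *v w = b"
    using B(1) by (force simp: mat_orbit_def)
  then obtain h where h: "\<And>b. b \<in> B \<Longrightarrow> h b \<in> G" "\<And>b. b \<in> B \<Longrightarrow> h b *v w = b"
    by metis
  \<comment> \<open>Coordinates with respect to a basis of the whole space are linear everywhere, and they agree on
    the span of \<open>B\<close> with those with respect to \<open>B\<close>.\<close>
  define B' where "B' = vec.extend_basis B"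
  have B': "B \<subseteq> B'" "vec.independent B'" "vec.span B' = UNIV"
    unfolding B'_def
    using vec.extend_basis_superset[OF B(2)] vec.independent_extend_basis[OF B(2)]
      vec.span_extend_basis[OF B(2)] by auto
  define r where "r e b = vec.representation B' e b" for e b
  have "\<forall>b. \<exists>K>0. \<forall>e. norm (r e b) \<le> norm e * K"
    using bounded_linear.pos_bounded[OF bounded_linear_representation[OF B'(2,3)]]
    unfolding r_def by blast
  then obtain K where K: "\<And>b. K b > 0" "\<And>e b. norm (r e b) \<le> norm e * K b"
    by metis
  have "\<forall>b. \<exists>C>0. \<forall>y. norm (h b *v y) \<le> norm y * C"
    using bounded_linear.pos_bounded[OF bounded_linear_matrix_vector_mult] by blast
  then obtain C where C: "\<And>b. C b > 0" "\<And>b y. norm (h b *v y) \<le> norm y * C b"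
    by metis
  define M where "M = (\<Sum>b\<in>B. K b * C b)"
  have M: "M \<ge> 0"
    unfolding M_def using K(1) C(1) by (intro sum_nonneg) (simp add: less_imp_le)
  show ?thesis
  proof (rule that)
    show "\<epsilon> / (M + 1) > 0" using eps M by simp
  next
    fix e assume e: "e \<in> vec.span (mat_orbit G w)" and small: "norm e < \<epsilon> / (M + 1)"
    define c where "c y = (\<Sum>b\<in>B. r e b *s (h b *v y))" for y
    have "c w = (\<Sum>b\<in>B. vec.representation B e b *s b)"
      unfolding c_def r_def using vec.representation_extend[OF B'(2) _ B'(1), of e] e spanB h(2)
      by (intro sum.cong) auto
    also have "\<dots> = e"
      using e spanB by (intro vec.sum_representation_eq[OF B(2) _ finB]) auto
    finally have "c w = e" .
    moreover have "c (A *v y) = A *v c y" if A: "A \<in> G" for A y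
    proof -
      have "h b *v (A *v y) = A *v (h b *v y)" if "b \<in> B" for b
        using abelian_linear_group_commute[OF G h(1)[OF that] A]
        by (simp add: matrix_vector_mul_assoc)
      then show ?thesis
        unfolding c_def by (simp add: vec.sum vec.scale)
    qed
    moreover have "norm (c y) \<le> \<epsilon> * norm y" for y
    proof -
      have "norm (c y) \<le> (\<Sum>b\<in>B. norm (r e b *s (h b *v y)))"
        unfolding c_def by (rule norm_sum)
      also have "\<dots> \<le> (\<Sum>b\<in>B. (norm e * K b) * (norm y * C b))"
        unfolding norm_vector_scale using K C
        by (intro sum_mono mult_mono) (auto simp: less_imp_le)
      also have "\<dots> = norm e * M * norm y"
        unfolding M_def by (simp add: sum_distrib_left sum_distrib_right mult_ac)
      also have "norm e * M \<le> \<epsilon>"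
      proof -
        have "norm e * M \<le> norm e * (M + 1)" by (simp add: mult_left_mono)
        also have "\<dots> \<le> \<epsilon>" using small M by (simp add: pos_less_divide_eq)
        finally show ?thesis .
      qed
      finally show ?thesis by (simp add: mult_right_mono)
    qed
    ultimately show "\<exists>c. c w = e \<and> (\<forall>A\<in>G. \<forall>y. c (A *v y) = A *v c y) \<and>
        (\<forall>y. norm (c y) \<le> \<epsilon> * norm y)" by blast
  qed
qed

text \<open>The membership of \<open>v\<close> in the span of the orbit of \<open>w\<close> is what excludes degeneration: it puts
  the error \<open>w - g v\<close> into this span, where it is the value at \<open>w\<close> of an operator that commutes
  with the group.\<close>

lemma mem_closure_orbit_sym:
  fixes G :: "('k::{euclidean_space,real_normed_field} ^ 'n ^ 'n) set"
  assumes G: "abelian_linear_group G"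
    and w: "w \<in> closure (mat_orbit G v)" and v: "v \<in> vec.span (mat_orbit G w)"
  shows "v \<in> closure (mat_orbit G w)"
  unfolding closure_approachable
proof (intro allI impI)
  fix \<eta> :: real assume \<eta>: "\<eta> > 0"
  define \<epsilon> where "\<epsilon> = min (1/2) (\<eta> / (2 * (norm v + 1)))"
  have pos: "norm v + 1 > 0" by (simp add: add_nonneg_pos)
  have \<epsilon>: "\<epsilon> > 0" "\<epsilon> \<le> 1/2" "2 * \<epsilon> * norm v < \<eta>"
  proof -
    show e0: "\<epsilon> > 0" using \<eta> pos by (simp add: \<epsilon>_def)
    show "\<epsilon> \<le> 1/2" unfolding \<epsilon>_def by (rule min.cobounded1)
    have "\<epsilon> \<le> \<eta> / (2 * (norm v + 1))" by (simp add: \<epsilon>_def)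
    then have "\<epsilon> * (2 * (norm v + 1)) \<le> \<eta>"
      using pos by (subst (asm) pos_le_divide_eq) auto
    then show "2 * \<epsilon> * norm v < \<eta>" using e0 by (simp add: algebra_simps)
  qed
  obtain \<delta> where \<delta>: "\<delta> > 0"
    "\<And>e. e \<in> vec.span (mat_orbit G w) \<Longrightarrow> norm e < \<delta> \<Longrightarrow>
      \<exists>c. c w = e \<and> (\<forall>A\<in>G. \<forall>y. c (A *v y) = A *v c y) \<and> (\<forall>y. norm (c y) \<le> \<epsilon> * norm y)"
    using ex_small_commuting_operator[OF G \<epsilon>(1)] by blast
  obtain u where u: "u \<in> mat_orbit G v" "dist u w < \<delta>"
    using w \<delta>(1) unfolding closure_approachable by blast
  then obtain A where A: "A \<in> G" "dist (A *v v) w < \<delta>"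
    unfolding mat_orbit_def by blast
  obtain B where B: "B \<in> G" "B ** A = mat 1"
    using abelian_linear_group_inverse[OF G A(1)] .
  have "A *v v \<in> vec.span (mat_orbit G w)"
  proof -
    have "(*v) A ` mat_orbit G w \<subseteq> mat_orbit G w"
      using A(1)
      by (force simp: mat_orbit_def matrix_vector_mul_assoc abelian_linear_group_mult[OF G])
    then have "vec.span ((*v) A ` mat_orbit G w) \<subseteq> vec.span (mat_orbit G w)"
      by (rule vec.span_mono)
    then show ?thesis
      using v by (auto simp: vec.span_image)
  qed
  then have e: "w - A *v v \<in> vec.span (mat_orbit G w)"
    by (rule vec.span_diff[OF vec.span_base[OF mat_orbit_refl[OF G]]])
  have "norm (w - A *v v) < \<delta>"
    using A(2) by (metis dist_norm dist_commute)
  then obtain c where c: "c w = w - A *v v" "\<And>A y. A \<in> G \<Longrightarrow> c (A *v y) = A *v c y"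
    "\<And>y. norm (c y) \<le> \<epsilon> * norm y"
    using \<delta>(2)[OF e] by blast
  define y where "y = B *v w"
  have "c y = B *v (w - A *v v)"
    unfolding y_def using c(1,2) B(1) by simp
  also have "\<dots> = y - v"
    using B(2) by (simp add: y_def vec.diff matrix_vector_mul_assoc)
  finally have "norm (y - v) \<le> \<epsilon> * norm y"
    using c(3)[of y] by simp
  also have "\<dots> \<le> \<epsilon> * (norm (y - v) + norm v)"
    using \<epsilon>(1) norm_triangle_ineq[of "y - v" v] by (intro mult_left_mono) auto
  also have "\<dots> \<le> 1/2 * norm (y - v) + \<epsilon> * norm v"
    using \<epsilon>(2) mult_right_mono[OF \<epsilon>(2), of "norm (y - v)"] by (simp add: distrib_left)
  finally have "dist y v < \<eta>"
    using \<epsilon>(3) by (simp add: dist_norm)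
  moreover have "y \<in> mat_orbit G w"
    unfolding y_def using B(1) by (rule mat_orbitI)
  ultimately show "\<exists>y\<in>mat_orbit G w. dist y v < \<eta>" by blast
qed

lemma dim_orbit_less:
  fixes G :: "('k::{euclidean_space,real_normed_field} ^ 'n ^ 'n) set"
  assumes G: "abelian_linear_group G" and L: "L \<in> mat_orbits G" and M: "M \<in> mat_orbits G"
    and less: "closure M \<subset> closure L"
  shows "vec.dim M < vec.dim L"
proof (rule ccontr)
  assume "\<not> vec.dim M < vec.dim L"
  then have dim: "vec.dim L \<le> vec.dim M" by simp
  obtain v w where v: "L = mat_orbit G v" and w: "M = mat_orbit G w"
    using L M by (auto simp: mat_orbits_def)
  have "closure L \<subseteq> vec.span L"
    by (intro closure_minimal vec.span_superset closed_vec_subspace vec.subspace_span)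
  then have "M \<subseteq> vec.span L"
    using less closure_subset[of M] by blast
  then have "vec.span M \<subseteq> vec.span L"
    by (rule vec.span_minimal[OF _ vec.subspace_span])
  then have "vec.span M = vec.span L"
    using dim by (intro vec.subspace_dim_equal vec.subspace_span) auto
  then have "v \<in> vec.span (mat_orbit G w)"
    using mat_orbit_refl[OF G, of v] v w by (auto intro: vec.span_base)
  moreover have "w \<in> closure (mat_orbit G v)"
    using less closure_subset[of M] mat_orbit_refl[OF G, of w] v w by blast
  ultimately have "v \<in> closure M"
    using mem_closure_orbit_sym[OF G] w by blast
  then have "L \<subseteq> closure M"
    using mat_orbit_subset_closure[OF G] v w by blast
  then have "closure L \<subseteq> closure M"
    by (simp add: closure_minimal)
  then show False using less by blast
qed

section \<open>Levels\<close>

lemma minimal_orbitI: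
  fixes G :: "('k::{euclidean_space,real_normed_field} ^ 'n ^ 'n) set"
  assumes G: "abelian_linear_group G" and L: "L \<in> mat_orbits G" "L \<noteq> {0}"
    and below: "\<And>M. M \<in> mat_orbits G \<Longrightarrow> closure M \<subset> closure L \<Longrightarrow> M = {0}"
  shows "minimal_orbit G (UNIV - {0}) L"
proof -
  have L0: "L \<subseteq> UNIV - {0}"
    using mat_orbits_nonzero[OF G L] .
  obtain v where v: "L = mat_orbit G v"
    using L(1) by (auto simp: mat_orbits_def)
  have "mat_orbit G x \<subseteq> closure L \<inter> (UNIV - {0})" if "x \<in> closure L \<inter> (UNIV - {0})" for x
  proof -
    have "mat_orbit G x \<in> mat_orbits G" "mat_orbit G x \<noteq> {0}"
      using that mat_orbit_refl[OF G, of x] by (auto simp: mat_orbits_def)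
    then have "mat_orbit G x \<subseteq> UNIV - {0}"
      by (rule mat_orbits_nonzero[OF G])
    then show ?thesis
      using mat_orbit_subset_closure[OF G, of x v] that v by blast
  qed
  then have "invariant_set G (closure L \<inter> (UNIV - {0}))"
    by (simp only: invariant_set_iff[OF G] Ball_def) blast
  moreover have "closure L \<inter> (UNIV - {0}) \<noteq> {}"
    using L0 mat_orbits_nonempty[OF G L(1)] closure_subset[of L] by blast
  ultimately have "closed_invariant_in G (UNIV - {0}) (closure L \<inter> (UNIV - {0}))"
    unfolding closed_invariant_in_def by (auto simp: closedin_closed)
  moreover have "\<not> closed_invariant_in G (UNIV - {0}) T"
    if T: "T \<subset> closure L \<inter> (UNIV - {0})" for T
  proof
    assume T': "closed_invariant_in G (UNIV - {0}) T"
    then obtain x where x: "x \<in> T" by (auto simp: closed_invariant_in_def)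
    define M where "M = mat_orbit G x"
    have M: "M \<in> mat_orbits G" "M \<subseteq> T" "M \<noteq> {0}"
      using T' x T mat_orbit_refl[OF G, of x]
      by (auto simp: M_def mat_orbits_def closed_invariant_in_def invariant_set_iff[OF G])
    obtain C where C: "closed C" "T = (UNIV - {0}) \<inter> C"
      using T' by (auto simp: closed_invariant_in_def closedin_closed)
    have "closure M \<subseteq> C"
      using C M(2) by (intro closure_minimal) auto
    moreover have "closure M \<subseteq> closure L"
      using M(2) T by (intro closure_minimal) auto
    ultimately have "closure M \<subset> closure L"
      using T C(2) by blast
    then show False using below M by blast
  qed
  ultimately show ?thesis
    using L(1) L0 by (simp add: minimal_orbit_def minimal_set_def)
qed

text \<open>Call an orbit below \<open>L\<close> if its closure is strictly smaller. The level of \<open>L \<noteq> {0}\<close> is the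
  least positive number that exceeds the levels of all orbits below \<open>L\<close>. If it is not \<open>1\<close>, it is
  the successor of the level of some orbit \<open>M\<close> below \<open>L\<close>, and the orbits below \<open>M\<close> already
  realize all smaller positive levels.\<close>

lemma ex_level_le_dim:
  fixes G :: "('k::{euclidean_space,real_normed_field} ^ 'n ^ 'n) set"
  assumes G: "abelian_linear_group G"
  shows "L \<in> mat_orbits G \<Longrightarrow> \<exists>p \<le> vec.dim L. at_level G p L"
proof (induction "vec.dim L" arbitrary: L rule: less_induct)
  case less
  note L = less.prems
  show ?case
  proof (cases "L = {0}")
    case True
    then show ?thesis using level_zero by blast
  next
    case False
    then have L0: "L \<subseteq> UNIV - {0}" using mat_orbits_nonzero[OF G L] by blast
    define P where "P = {k. \<exists>M\<in>mat_orbits G. closure M \<subset> closure L \<and> at_level G k M}"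
    have below: "\<exists>k\<in>P. at_level G k M"
      if "M \<in> mat_orbits G" "closure M \<subset> closure L" for M
      using less.hyps[OF dim_orbit_less[OF G L that] that(1)] that unfolding P_def by blast
    have bound: "k < vec.dim L" if k: "k \<in> P" for k
    proof -
      obtain M where M: "M \<in> mat_orbits G" "closure M \<subset> closure L" "at_level G k M"
        using k unfolding P_def by blast
      obtain p where "p \<le> vec.dim M" "at_level G p M"
        using less.hyps[OF dim_orbit_less[OF G L M(1,2)] M(1)] by blast
      then show ?thesis
        using at_level_unique[OF M(3)] dim_orbit_less[OF G L M(1,2)] by (metis order_le_less_trans)
    qed
    then have finP: "finite P"
      by (intro finite_subset[of P "{..<vec.dim L}"]) auto
    have dim: "1 \<le> vec.dim L"
    proof -
      have "\<not> L \<subseteq> {0}" using L0 mat_orbits_nonempty[OF G L] by blast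
      then have "vec.dim L \<noteq> 0" by simp
      then show ?thesis by linarith
    qed
    show ?thesis
    proof (cases "P \<subseteq> {0}")
      case True
      have "M = {0}" if M: "M \<in> mat_orbits G" "closure M \<subset> closure L" for M
      proof -
        obtain k where k: "k \<in> P" "at_level G k M" using below[OF M] by blast
        then have "k = 0" using True by blast
        then show ?thesis using k(2) at_level_zeroD by blast
      qed
      then have "minimal_orbit G (UNIV - {0}) L"
        by (rule minimal_orbitI[OF G L \<open>L \<noteq> {0}\<close>])
      then show ?thesis using level_one dim by blast
    next
      case False
      define m where "m = Max P"
      have m: "m \<in> P" "\<And>k. k \<in> P \<Longrightarrow> k \<le> m"
        using finP False by (auto simp: m_def intro: Max_in)
      have "m \<ge> 1"
        using False m(2) by force
      obtain M where M: "M \<in> mat_orbits G" "closure M \<subset> closure L" "at_level G m M"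
        using m(1) unfolding P_def by blast
      have "at_level G (Suc m) L"
      proof (rule level_step)
        show "2 \<le> Suc m" using \<open>m \<ge> 1\<close> by simp
        show "\<forall>N\<in>mat_orbits G. N \<subseteq> closure L - orbit_class G L \<longrightarrow> (\<exists>k<Suc m. at_level G k N)"
        proof (intro ballI impI)
          fix N assume N: "N \<in> mat_orbits G" "N \<subseteq> closure L - orbit_class G L"
          then obtain k where "k \<in> P" "at_level G k N"
            using below[OF N(1)] orbit_below_iff[OF G N(1)] by blast
          then show "\<exists>k<Suc m. at_level G k N"
            using m(2) by (auto simp: less_Suc_eq_le)
        qed
        show "\<forall>k. 1 \<le> k \<and> k < Suc m \<longrightarrow>
            (\<exists>N\<in>mat_orbits G. N \<subseteq> closure L - orbit_class G L \<and> at_level G k N)"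
        proof (intro allI impI)
          fix k assume k: "1 \<le> k \<and> k < Suc m"
          show "\<exists>N\<in>mat_orbits G. N \<subseteq> closure L - orbit_class G L \<and> at_level G k N"
          proof (cases "k = m")
            case True
            then show ?thesis using M orbit_below_iff[OF G M(1)] by blast
          next
            case False
            then obtain N where N: "N \<in> mat_orbits G" "N \<subseteq> closure M - orbit_class G M"
                "at_level G k N"
              using at_level_attained[OF M(3), of k] k by auto
            then have "closure N \<subset> closure L"
              using M(2) orbit_below_iff[OF G N(1)] by blast
            then show ?thesis
              using N orbit_below_iff[OF G N(1)] by blast
          qed
        qed
      qed (use L L0 in auto)
      then show ?thesis using bound[OF m(1)] by (auto intro: Suc_leI)
    qed
  qed
qed

lemma height_le_dimension:
  fixes G :: "('k::{euclidean_space,real_normed_field} ^ 'n ^ 'n) set"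
  assumes G: "abelian_linear_group G"
  shows "height G \<le> enat CARD('n)"
  unfolding height_def
proof (rule SUP_least)
  fix L assume "L \<in> mat_orbits G"
  then obtain p where p: "p \<le> vec.dim L" "at_level G p L"
    using ex_level_le_dim[OF G] by blast
  have "orbit_level G L \<le> enat p"
    unfolding orbit_level_def using p(2) by (intro Inf_lower) blast
  also have "\<dots> \<le> enat CARD('n)"
    using p(1) dim_subset_UNIV_cart_gen[of L] by simp
  finally show "orbit_level G L \<le> enat CARD('n)" .
qed

theorem corollary1p2:
  "(\<forall>G :: (real ^ 'n ^ 'n) set. abelian_linear_group G \<longrightarrow> height G \<le> enat CARD('n)) \<and>
   (\<forall>G :: (complex ^ 'n ^ 'n) set. abelian_linear_group G \<longrightarrow> height G \<le> enat CARD('n))"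
  by (simp add: height_le_dimension)

end
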